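(* Suppose there exists $\zeta:\mathbb{R}_{\ge0}\times\mathbb{R}_{\ge0}\to\mathbb{R}_{\ge0}$ such that, for any $s>0$, $\zeta(s,\cdot)\in\mathcal{K}$ and $\zeta(\cdot,s)$ is continuous and non-decreasing, and $c_{\mathrm{stop}}(x,\theta,\gamma,i)\le\zeta(\sigma(x),|\theta|)$ for all $x\in\mathbb{R}^{n_x}$, $\theta\in\Theta$, $\gamma\in(0,1]$, $i\in\mathbb{Z}_{\ge0}$. Then there exists $\beta\in\mathcal{KL}$ such that for any $\delta,\Delta>0$, any $\gamma\in[\gamma_\star,1]$ and any integer $i\ge2$, there exists $\overline\theta>0$ such that for any $x\in\mathcal{X}$ with $\sigma(x)\le\Delta$ and any $\theta\in\Theta$ with $|\theta|\le\overline\theta$, any solution $\widehat\phi_{\gamma,i,\theta}$ initialized at $x$ of the constrained inclusion $x(k+1)\in f(x(k),\widehat H_{\gamma,i}(x(k)))$, $x(k)\in\mathcal{X}$, satisfies $$\sigma(\widehat\phi_{\gamma,i,\theta}(k;x))\le\max\{\beta(\sigma(x),k),\delta\}\qquad\text{for all }k\in\operatorname{dom}\widehat\phi_{\gamma,i,\theta}.$$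
   Context: Let $n_x,n_u\in\mathbb{Z}_{>0}$, $f:\mathbb{R}^{n_x}\times\mathbb{R}^{n_u}\to\mathbb{R}^{n_x}$, $\mathcal{U}:\mathbb{R}^{n_x}\rightrightarrows\mathbb{R}^{n_u}$ a set-valued map (admissible inputs), $\mathcal{W}:=\{(x,u):u\in\mathcal{U}(x)\}$, $\ell:\mathbb{R}^{n_x}\times\mathbb{R}^{n_u}\to\mathbb{R}_{\ge 0}$ a stage cost. For $x\in\mathbb{R}^{n_x}$ and a sequence $\mathbf{u}=(u_0,u_1,\dots)$, $\phi(k;x,\mathbf{u}|_k)$ is the state at time $k$ of $x(k+1)=f(x(k),u_k)$, $x(0)=x$; $\mathbf{u}$ is admissible from $x$ if $u_k\in\mathcal{U}(\phi(k;x,\mathbf{u}|_k))$ for all $k\in\mathbb{Z}_{\ge0}$. For $\gamma\in(0,1]$, $V_{\gamma,\star}(x):=\inf_{\mathbf{u}}\sum_{k=0}^\infty\gamma^k\ell(\phi(k;x,\mathbf{u}|_k),u_k)$ over admissible $\mathbf{u}$. Given $V_{\gamma,0}:\mathbb{R}^{n_x}\to\mathbb{R}_{\ge0}$, value iteration defines for $i\in\mathbb{Z}_{>0}$, $V_{\gamma,i}(x):=\inf_{u\in\mathcal{U}(x)}(\ell(x,u)+\gamma V_{\gamma,i-1}(f(x,u)))$. $\sigma:\mathbb{R}^{n_x}\to\mathbb{R}_{\ge0}$ is a given continuous, surjective function. Class $\mathcal{K}$: continuous, strictly increasing functions $\mathbb{R}_{\ge0}\to\mathbb{R}_{\ge0}$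 vanishing at $0$; class $\mathcal{K}_\infty$: unbounded class-$\mathcal{K}$ functions; class $\mathcal{KL}$: functions $\beta:\mathbb{R}_{\ge0}\times\mathbb{R}_{\ge0}\to\mathbb{R}_{\ge0}$ with $\beta(\cdot,t)$ non-decreasing, $\lim_{r\to0^+}\beta(r,t)=0$, $\beta(r,\cdot)$ non-increasing and $\lim_{t\to\infty}\beta(r,t)=0$. Standing assumptions. (1) $f$ is continuous; each $\mathcal{U}(x)$ is non-empty and closed; $\ell$ is lower semicontinuous and there is $\alpha_\ell\in\mathcal{K}_\infty$ with $\ell(x,u)\ge\alpha_\ell(|u|)$ for all $(x,u)$; $V_{\gamma,0}$ is lower semicontinuous. (2) There exists $\underline\alpha\in\mathcal{K}_\infty$ with $\ell(x,u)\ge\underline\alpha(\sigma(x))$ for all $(x,u)\in\mathcal{W}$. (3) There exists $\overline\alpha\in\mathcal{K}_\infty$ with $V_{\gamma,i}(x)\le\overline\alpha(\sigma(x))$ and $V_{\gamma,\star}(x)\le\overline\alpha(\sigma(x))$ for all $i\in\mathbb{Z}_{\ge0}$, $\gamma\in(0,1]$, $x\in\mathbb{R}^{n_x}$. (4) There exist $\gamma_\star\in(0,1]$ and $\alpha\in\mathcal{K}_\infty$ with $\alpha(s)+(1-\gamma_\star)\overline\alpha(s)\le\underline\alpha(s)$ for all $s\ge0$. The stopping criterion function is $c_{\mathrm{stop}}:\mathbb{R}^{n_x}\times\Theta\times(0,1]\times\mathbb{Z}_{\ge0}\to\mathbb{R}_{\ge0}$, with $\Theta\subset\mathbb{R}^{n_\theta}$,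 and $\mathcal{X}\subset\mathbb{R}^{n_x}$ is a given set. For $\theta\in\Theta$, $\gamma$ and $i\in\mathbb{Z}_{>0}$ (dependence on $\theta$ suppressed), $$\widehat H_{\gamma,i}(x):=\{u\in\mathcal{U}(x):\ell(x,u)+\gamma V_{\gamma,i-1}(f(x,u))\le V_{\gamma,i-1}(x)+c_{\mathrm{stop}}(x,\theta,\gamma,i)\},$$ which may be empty. A solution $\widehat\phi_{\gamma,i,\theta}(\cdot;x)$ initialized at $x\in\mathcal{X}$ of $x(k+1)\in f(x(k),\widehat H_{\gamma,i}(x(k)))$, $x(k)\in\mathcal{X}$, is a sequence defined on a domain of the form $\{0,\dots,K\}$ or $\mathbb{Z}_{\ge0}$, with value $x$ at $0$, all values in $\mathcal{X}$, and whose value at $k+1$ belongs to $\{f(z,u):u\in\widehat H_{\gamma,i}(z)\}$, $z$ being its value at $k$, whenever $k+1$ is in the domain.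
   Formalization: The additional hypothesis ζ(0,0)=0 is assumed; the conditions for s>0 leave ζ(0,0) free, and without it a state with σ(x)=0 can be left by a large jump at θ=0, making the claim false. *)

theory Defs
  imports "HOL-Analysis.Analysis"
begin

text \<open>
  Functions on the nonnegative reals are represented by functions on all of \<open>real\<close>;
  the definitions below only constrain them on \<open>{0..}\<close>.
\<close>

definition class_K :: "(real \<Rightarrow> real) \<Rightarrow> bool" where
  "class_K a \<longleftrightarrow> continuous_on {0..} a \<and> strict_mono_on {0..} a \<and> a 0 = 0"

definition class_K_inf :: "(real \<Rightarrow> real) \<Rightarrow> bool" where
  "class_K_inf a \<longleftrightarrow> class_K a \<and> \<not> bdd_above (a ` {0..})"

definition class_KL :: "(real \<Rightarrow> real \<Rightarrow> real) \<Rightarrow> bool" where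
  "class_KL \<beta> \<longleftrightarrow>
     (\<forall>r\<ge>0. \<forall>t\<ge>0. 0 \<le> \<beta> r t) \<and>
     (\<forall>t\<ge>0. mono_on {0..} (\<lambda>r. \<beta> r t) \<and> ((\<lambda>r. \<beta> r t) \<longlongrightarrow> 0) (at_right 0)) \<and>
     (\<forall>r\<ge>0. antimono_on {0..} (\<beta> r) \<and> (\<beta> r \<longlongrightarrow> 0) at_top)"

definition lower_semicontinuous :: "('a::topological_space \<Rightarrow> real) \<Rightarrow> bool" where
  "lower_semicontinuous g \<longleftrightarrow> (\<forall>x c. c < g x \<longrightarrow> (\<forall>\<^sub>F y in nhds x. c < g y))"

text \<open>The state at time \<open>k\<close>; only the inputs \<open>u 0, \<dots>, u (k - 1)\<close> enter.\<close>

primrec trajectory :: "('x \<Rightarrow> 'u \<Rightarrow> 'x) \<Rightarrow> 'x \<Rightarrow> (nat \<Rightarrow> 'u) \<Rightarrow> nat \<Rightarrow> 'x" where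
  "trajectory f x u 0 = x"
| "trajectory f x u (Suc k) = f (trajectory f x u k) (u k)"

definition admissible :: "('x \<Rightarrow> 'u \<Rightarrow> 'x) \<Rightarrow> ('x \<Rightarrow> 'u set) \<Rightarrow> 'x \<Rightarrow> (nat \<Rightarrow> 'u) \<Rightarrow> bool" where
  "admissible f U x u \<longleftrightarrow> (\<forall>k. u k \<in> U (trajectory f x u k))"

text \<open>
  The cost of an input sequence may be infinite, so the optimal value function takes its
  values in \<open>ennreal\<close>.
\<close>

definition optimal_value ::
  "('x \<Rightarrow> 'u \<Rightarrow> 'x) \<Rightarrow> ('x \<Rightarrow> 'u set) \<Rightarrow> ('x \<Rightarrow> 'u \<Rightarrow> real) \<Rightarrow> real \<Rightarrow> 'x \<Rightarrow> ennreal" where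
  "optimal_value f U l \<gamma> x =
     (INF u\<in>{u. admissible f U x u}. \<Sum>k. ennreal (\<gamma> ^ k * l (trajectory f x u k) (u k)))"

text \<open>
  Here \<open>V0 \<gamma>\<close> is the initial function for the discount factor \<open>\<gamma>\<close>. The infimum is the one
  of \<open>real\<close>: it is meaningful when \<open>U x\<close> is nonempty and \<open>l\<close>, \<open>V0 \<gamma>\<close>, \<open>\<gamma>\<close> are nonnegative.
\<close>

primrec value_iter ::
  "('x \<Rightarrow> 'u \<Rightarrow> 'x) \<Rightarrow> ('x \<Rightarrow> 'u set) \<Rightarrow> ('x \<Rightarrow> 'u \<Rightarrow> real) \<Rightarrow> (real \<Rightarrow> 'x \<Rightarrow> real) \<Rightarrow>
    real \<Rightarrow> nat \<Rightarrow> 'x \<Rightarrow> real" where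
  "value_iter f U l V0 \<gamma> 0 = V0 \<gamma>"
| "value_iter f U l V0 \<gamma> (Suc i) =
     (\<lambda>x. INF u\<in>U x. l x u + \<gamma> * value_iter f U l V0 \<gamma> i (f x u))"

text \<open>Used for \<open>i > 0\<close> only, so that \<open>i - 1\<close> is the genuine predecessor.\<close>

definition H_hat ::
  "('x \<Rightarrow> 'u \<Rightarrow> 'x) \<Rightarrow> ('x \<Rightarrow> 'u set) \<Rightarrow> ('x \<Rightarrow> 'u \<Rightarrow> real) \<Rightarrow> (real \<Rightarrow> 'x \<Rightarrow> real) \<Rightarrow>
    ('x \<Rightarrow> 'p \<Rightarrow> real \<Rightarrow> nat \<Rightarrow> real) \<Rightarrow> real \<Rightarrow> nat \<Rightarrow> 'p \<Rightarrow> 'x \<Rightarrow> 'u set" where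
  "H_hat f U l V0 c_stop \<gamma> i \<theta> x =
     {u \<in> U x. l x u + \<gamma> * value_iter f U l V0 \<gamma> (i - 1) (f x u)
                 \<le> value_iter f U l V0 \<gamma> (i - 1) x + c_stop x \<theta> \<gamma> i}"

text \<open>
  \<open>constrained_solution f H X x D \<phi>\<close>: the sequence \<open>\<phi>\<close>, considered on its domain \<open>D\<close> only,
  is a solution of \<open>x(k+1) \<in> f (x(k), H (x(k)))\<close>, \<open>x(k) \<in> X\<close>, with initial value \<open>x\<close>.
  Solutions need not be maximal.
\<close>

definition constrained_solution ::
  "('x \<Rightarrow> 'u \<Rightarrow> 'x) \<Rightarrow> ('x \<Rightarrow> 'u set) \<Rightarrow> 'x set \<Rightarrow> 'x \<Rightarrow> nat set \<Rightarrow> (nat \<Rightarrow> 'x) \<Rightarrow> bool" where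
  "constrained_solution f H X x D \<phi> \<longleftrightarrow>
     (D = UNIV \<or> (\<exists>K. D = {..K})) \<and>
     \<phi> 0 = x \<and>
     (\<forall>k\<in>D. \<phi> k \<in> X) \<and>
     (\<forall>k. Suc k \<in> D \<longrightarrow> \<phi> (Suc k) \<in> {f (\<phi> k) u | u. u \<in> H (\<phi> k)})"

text \<open>
  The bound \<open>\<zeta> s t\<close> on the stopping criterion has \<open>\<zeta> s\<close> of class K and \<open>\<lambda>r. \<zeta> r s\<close> continuous
  and nondecreasing for \<open>s > 0\<close>. These conditions leave \<open>\<zeta> 0 0\<close> completely free, so the intended
  value \<open>\<zeta> 0 0 = 0\<close> (equivalently, continuity of \<open>\<lambda>r. \<zeta> r 0\<close> at \<open>0\<close>) is required separately.
  Without it a state \<open>x\<close> with \<open>\<sigma> x = 0\<close> could be left by an arbitrarily large jump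
  even for the parameter \<open>\<theta> = 0\<close>.
\<close>

end

theory Submission
  imports Defs
begin

text \<open>
  The Lyapunov function is \<open>V\<close>, the value iterate with index \<open>i - 1 \<ge> 1\<close>. It lies between
  \<open>\<alpha>_lo \<circ> \<sigma>\<close> and \<open>\<alpha>_up \<circ> \<sigma>\<close>: the lower bound holds because at least one stage cost enters an
  iterate of positive index, and this is where \<open>i \<ge> 2\<close> is used. Along a solution the inequality
  defining \<open>H_hat\<close>, together with the bound on \<open>1 - \<gamma>\<close>, gives
  \<open>V x' \<le> V x + (c - \<alpha> (\<sigma> x)) / \<gamma>\<close>, with \<open>x'\<close> the successor of \<open>x\<close> and \<open>c\<close> the value of the
  stopping criterion (lemma \<open>relaxed_bellman_decrease\<close>).

  On a sublevel set of \<open>V\<close> that contains the initial states, \<open>\<sigma>\<close> is bounded, so \<open>c\<close> is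
  uniformly below any prescribed \<open>\<epsilon> > 0\<close> once \<open>norm \<theta>\<close> is small (lemma \<open>zeta_uniformly_small\<close>).
  A step from a state where \<open>\<alpha> \<circ> \<sigma>\<close> is at least \<open>2 * \<epsilon>\<close> decreases \<open>V\<close> by at least half of
  \<open>\<alpha> (\<sigma> x)\<close>; at all other states \<open>V\<close> is already tiny, and after the step it is still at most
  \<open>\<eta> = \<alpha>_lo \<delta>\<close> (lemma \<open>perturbed_decrease_dichotomy\<close>). In both cases the sublevel set is
  not left, which justifies the uniform bound on \<open>c\<close> for the next step.

  The rate comes from adding up the decreases. If \<open>V\<close> is above \<open>\<eta>\<close> up to time \<open>k\<close>, let \<open>m\<close> be the
  smallest value of \<open>\<sigma>\<close> before time \<open>k\<close>. Then \<open>V\<close> has dropped by at least \<open>k / 2 * \<alpha> m\<close>, while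
  monotonicity of \<open>V\<close> along the solution forces \<open>V\<close> at time \<open>k\<close> to be at most \<open>\<alpha>_up m\<close>. These two inequalities
  bound \<open>\<sigma>\<close> at time \<open>k\<close>, and the best bound that they imply, the function \<open>decay_bound\<close>, is of
  class KL. It depends on the three comparison functions only, hence not on \<open>\<delta>\<close>, \<open>\<Delta>\<close>, \<open>\<gamma>\<close> or \<open>i\<close>.
\<close>

section \<open>Comparison functions\<close>

lemma class_K_mono:
  assumes "class_K a" "0 \<le> x" "x \<le> y"
  shows "a x \<le> a y"
  using assms unfolding class_K_def strict_mono_on_def by (cases "x = y") (auto simp: less_imp_le)

lemma class_K_less_cancel:
  assumes "class_K a" "0 \<le> y" "a x < a y"
  shows "x < y"
  using class_K_mono[OF assms(1,2), of x] assms(3) by linarith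

lemma class_K_le_cancel:
  assumes "class_K a" "0 \<le> x" "0 \<le> y" "a x \<le> a y"
  shows "x \<le> y"
proof (rule ccontr)
  assume "\<not> x \<le> y"
  with assms(1,3) have "a y < a x"
    unfolding class_K_def strict_mono_on_def by auto
  with assms(4) show False by simp
qed

lemma class_K_pos:
  assumes "class_K a" "0 < x"
  shows "0 < a x"
  using assms unfolding class_K_def strict_mono_on_def by (metis atLeast_iff less_imp_le order_refl)

lemma class_K_nonneg:
  assumes "class_K a" "0 \<le> x"
  shows "0 \<le> a x"
  using class_K_mono[OF assms(1) order_refl assms(2)] assms(1) by (simp add: class_K_def)

lemma class_K_small:
  assumes a: "class_K a" and e: "0 < e"
  obtains d where "0 < d" "a d < e"
proof -
  have "continuous_on {0..} a" "a 0 = 0" using a by (auto simp: class_K_def)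
  then obtain d where d: "0 < d" "\<forall>x\<in>{0..}. dist x 0 < d \<longrightarrow> dist (a x) 0 < e"
    unfolding continuous_on_iff using e by force
  have "a (d / 2) < e" using d(2)[rule_format, of "d / 2"] d(1) by (simp add: dist_real_def)
  with d(1) that[of "d / 2"] show thesis by simp
qed

lemma class_K_inf_large:
  assumes a: "class_K_inf a"
  obtains S where "0 < S" "M \<le> a S"
proof -
  have "\<not> bdd_above (a ` {0..})" and K: "class_K a"
    using a by (auto simp: class_K_inf_def)
  then obtain s where s: "0 \<le> s" "M < a s"
    unfolding bdd_above_def by (auto simp: not_le)
  have "a s \<le> a (s + 1)" using s by (intro class_K_mono[OF K]) auto
  with s that[of "s + 1"] show thesis by linarith
qed

section \<open>The decay rate\<close>

text \<open>
  Here \<open>s\<close> is a possible value of \<open>\<sigma>\<close> at time \<open>t\<close> for a solution that starts where \<open>\<sigma>\<close> equals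
  \<open>r\<close>, and the witness \<open>m\<close> stands for the smallest value of \<open>\<sigma>\<close> before that time
  (for the initial value if \<open>t = 0\<close>).
\<close>

definition decay_set ::
  "(real \<Rightarrow> real) \<Rightarrow> (real \<Rightarrow> real) \<Rightarrow> (real \<Rightarrow> real) \<Rightarrow> real \<Rightarrow> real \<Rightarrow> real set" where
  "decay_set lo up a r t =
     {s. 0 \<le> s \<and> (\<exists>m\<ge>0. lo s \<le> up m \<and> lo s + t / 2 * a m \<le> up r)}"

definition decay_bound ::
  "(real \<Rightarrow> real) \<Rightarrow> (real \<Rightarrow> real) \<Rightarrow> (real \<Rightarrow> real) \<Rightarrow> real \<Rightarrow> real \<Rightarrow> real" where
  "decay_bound lo up a r t = Sup (decay_set lo up a r t)"

context
  fixes lo up a :: "real \<Rightarrow> real"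
  assumes lo: "class_K_inf lo" and up: "class_K up" and a: "class_K a"
begin

lemma lo_K: "class_K lo"
  using lo by (simp add: class_K_inf_def)

lemma decay_set_imp_le:
  assumes "s \<in> decay_set lo up a r t" "0 \<le> t"
  shows "0 \<le> s" "lo s \<le> up r"
proof -
  from assms(1) obtain m where m: "0 \<le> s" "0 \<le> m" "lo s + t / 2 * a m \<le> up r"
    by (auto simp: decay_set_def)
  have "0 \<le> t / 2 * a m" using assms(2) class_K_nonneg[OF a m(2)] by simp
  with m show "0 \<le> s" "lo s \<le> up r" by linarith+
qed

lemma zero_in_decay_set:
  assumes "0 \<le> r"
  shows "0 \<in> decay_set lo up a r t"
  using lo_K up a class_K_nonneg[OF up assms]
  by (auto simp: decay_set_def class_K_def intro!: exI[of _ 0])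

lemma decay_set_bdd_above:
  assumes "0 \<le> t"
  shows "bdd_above (decay_set lo up a r t)"
proof -
  obtain S where S: "0 < S" "up r \<le> lo S" using class_K_inf_large[OF lo] .
  have "s \<le> S" if "s \<in> decay_set lo up a r t" for s
    using decay_set_imp_le[OF that assms] S by (intro class_K_le_cancel[OF lo_K, of s S]) auto
  then show ?thesis by (auto simp: bdd_above_def)
qed

lemma le_decay_bound:
  assumes "0 \<le> t" "s \<in> decay_set lo up a r t"
  shows "s \<le> decay_bound lo up a r t"
  unfolding decay_bound_def using assms by (auto intro: cSup_upper decay_set_bdd_above)

lemma decay_bound_nonneg:
  assumes "0 \<le> r" "0 \<le> t"
  shows "0 \<le> decay_bound lo up a r t"
  using le_decay_bound[OF assms(2) zero_in_decay_set[OF assms(1)]] .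

lemma decay_bound_le:
  assumes "0 \<le> r" "\<And>s. s \<in> decay_set lo up a r t \<Longrightarrow> s \<le> e"
  shows "decay_bound lo up a r t \<le> e"
  unfolding decay_bound_def using zero_in_decay_set[OF assms(1)] assms(2)
  by (intro cSup_least) auto

lemma decay_bound_mono:
  assumes "0 \<le> r" "r \<le> r'" "0 \<le> t'" "t' \<le> t"
  shows "decay_bound lo up a r t \<le> decay_bound lo up a r' t'"
proof -
  have "s \<in> decay_set lo up a r' t'" if "s \<in> decay_set lo up a r t" for s
  proof -
    from that obtain m where m: "0 \<le> s" "0 \<le> m" "lo s \<le> up m" "lo s + t / 2 * a m \<le> up r"
      by (auto simp: decay_set_def)
    have "t' / 2 * a m \<le> t / 2 * a m"
      using class_K_nonneg[OF a m(2)] assms by (intro mult_right_mono) auto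
    moreover have "up r \<le> up r'" using assms by (intro class_K_mono[OF up])
    ultimately show ?thesis using m by (auto simp: decay_set_def intro!: exI[of _ m])
  qed
  then show ?thesis
    using assms by (auto intro: decay_bound_le le_decay_bound)
qed

text \<open>Since \<open>lo s \<le> up r\<close> on the decay set, a small \<open>up r\<close> leaves room for small \<open>s\<close> only.\<close>

lemma decay_bound_tendsto_right_0:
  assumes "0 \<le> t"
  shows "((\<lambda>r. decay_bound lo up a r t) \<longlongrightarrow> 0) (at_right 0)"
proof (rule tendstoI)
  fix e :: real assume e: "0 < e"
  obtain d where d: "0 < d" "up d < lo (e / 2)"
    using class_K_small[OF up class_K_pos[OF lo_K]] e by (metis half_gt_zero)
  have "dist (decay_bound lo up a r t) 0 < e" if r: "0 < r" "r < d" for r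
  proof -
    have upr: "up r \<le> up d" using r by (intro class_K_mono[OF up]) auto
    have "decay_bound lo up a r t \<le> e / 2"
    proof (rule decay_bound_le)
      fix s assume "s \<in> decay_set lo up a r t"
      from decay_set_imp_le[OF this assms] d(2) e upr show "s \<le> e / 2"
        by (intro class_K_le_cancel[OF lo_K, of s "e / 2"]) auto
    qed (use r in auto)
    with e decay_bound_nonneg[of r t] r assms show ?thesis by (simp add: dist_real_def)
  qed
  then show "\<forall>\<^sub>F r in at_right 0. dist (decay_bound lo up a r t) 0 < e"
    unfolding eventually_at_right_field using d(1) by blast
qed

text \<open>
  If \<open>s\<close> stays above \<open>e\<close>, then \<open>lo s \<le> up m\<close> keeps the witness \<open>m\<close> away from \<open>0\<close>, so that the
  accumulated decrease \<open>t / 2 * a m\<close> eventually exceeds the available \<open>up r\<close>.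
\<close>

lemma decay_bound_tendsto_at_top:
  assumes r: "0 \<le> r"
  shows "(decay_bound lo up a r \<longlongrightarrow> 0) at_top"
proof (rule tendstoI)
  fix e :: real assume e: "0 < e"
  obtain d where d: "0 < d" "up d < lo (e / 2)"
    using class_K_small[OF up class_K_pos[OF lo_K]] e by (metis half_gt_zero)
  have ad: "0 < a d" using class_K_pos[OF a d(1)] .
  define T where "T = 2 * up r / a d"
  have T: "0 \<le> T" using ad class_K_nonneg[OF up r] by (simp add: T_def)
  have "dist (decay_bound lo up a r t) 0 < e" if t: "T < t" for t
  proof -
    have "s \<le> e / 2" if "s \<in> decay_set lo up a r t" for s
    proof (rule ccontr)
      assume s: "\<not> s \<le> e / 2"
      from that obtain m where m: "0 \<le> s" "0 \<le> m" "lo s \<le> up m" "lo s + t / 2 * a m \<le> up r"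
        by (auto simp: decay_set_def)
      have "lo (e / 2) \<le> lo s" using e s by (intro class_K_mono[OF lo_K]) auto
      with d(2) m(3) have "d < m" using m(2) by (intro class_K_less_cancel[OF up, of m d]) auto
      then have "a d \<le> a m" using d(1) by (intro class_K_mono[OF a]) auto
      then have "t / 2 * a d \<le> t / 2 * a m" using t T by (intro mult_left_mono) auto
      moreover have "up r < t / 2 * a d" using t ad by (simp add: T_def field_simps)
      ultimately show False using m(4) class_K_nonneg[OF lo_K m(1)] by linarith
    qed
    then have "decay_bound lo up a r t \<le> e / 2"
      using decay_bound_le[OF r] by blast
    with e decay_bound_nonneg[of r t] r t T show ?thesis by (simp add: dist_real_def)
  qed
  then show "\<forall>\<^sub>F t in at_top. dist (decay_bound lo up a r t) 0 < e"
    unfolding eventually_at_top_dense by blast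
qed

lemma class_KL_decay_bound: "class_KL (decay_bound lo up a)"
  unfolding class_KL_def
  using decay_bound_nonneg decay_bound_tendsto_right_0 decay_bound_tendsto_at_top
  by (auto simp: monotone_on_def intro!: decay_bound_mono)

end

section \<open>Sequences with perturbed decrease\<close>

text \<open>
  If \<open>\<alpha> s \<ge> 2 * \<epsilon>\<close>, the perturbation \<open>c\<close> uses up at most half of the decrease. Otherwise \<open>s\<close> is
  below \<open>d\<close>, so that \<open>v \<le> \<eta> / 2\<close>, and the perturbation adds at most another \<open>\<eta> / 2\<close>.
\<close>

lemma perturbed_decrease_dichotomy:
  fixes v v' s c \<gamma> \<eta> \<epsilon> d :: real
  assumes up: "class_K up" and al: "class_K \<alpha>"
    and \<gamma>: "0 < \<gamma>" "\<gamma> \<le> 1"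
    and s: "0 \<le> s" "v \<le> up s"
    and step: "v' \<le> v + (c - \<alpha> s) / \<gamma>"
    and c: "c \<le> \<epsilon>"
    and d: "0 \<le> d" "up d \<le> \<eta> / 2"
    and \<epsilon>: "2 * \<epsilon> \<le> \<alpha> d" "\<epsilon> / \<gamma> \<le> \<eta> / 2"
  shows "v' \<le> \<eta> \<or> v' \<le> v - \<alpha> s / 2"
proof (cases "\<alpha> s < 2 * \<epsilon>")
  case True
  then have "s < d" using \<epsilon>(1) d(1) by (intro class_K_less_cancel[OF al, of d s]) auto
  then have "up s \<le> up d" using s by (intro class_K_mono[OF up]) auto
  moreover have "(c - \<alpha> s) / \<gamma> \<le> \<epsilon> / \<gamma>"
    using c class_K_nonneg[OF al s(1)] \<gamma> by (intro divide_right_mono) auto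
  ultimately show ?thesis using step s d \<epsilon> by linarith
next
  case False
  have "(c - \<alpha> s) / \<gamma> \<le> (- (\<alpha> s / 2)) / \<gamma>"
    using c False \<gamma> by (intro divide_right_mono) auto
  also have "\<dots> \<le> - (\<alpha> s / 2)"
    using \<gamma> class_K_nonneg[OF al s(1)] by (simp add: field_simps mult_left_le_one_le)
  finally show ?thesis using step by linarith
qed

text \<open>
  The level \<open>M\<close> is carried along because the one-step dichotomy is available on the sublevel set
  of \<open>M\<close> only; both of its alternatives keep the sequence in that set. The witness \<open>m\<close> is the
  running minimum of \<open>s\<close>.
\<close>

lemma accumulated_decrease:
  fixes v s :: "nat \<Rightarrow> real"
  assumes up: "class_K up" and al: "class_K \<alpha>"
    and s: "\<And>k. 0 \<le> s k" "\<And>k. v k \<le> up (s k)"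
    and M: "v 0 \<le> M" "\<eta> \<le> M"
    and step: "\<And>k. k < n \<Longrightarrow> v k \<le> M \<Longrightarrow> v (Suc k) \<le> \<eta> \<or> v (Suc k) \<le> v k - \<alpha> (s k) / 2"
  shows "v n \<le> \<eta> \<or> (\<exists>m\<ge>0. v n \<le> up m \<and> v n + real n / 2 * \<alpha> m \<le> v 0)"
  using step
proof (induction n)
  case 0
  show ?case using s by (auto intro!: exI[of _ "s 0"])
next
  case (Suc n)
  have IH: "v n \<le> \<eta> \<or> (\<exists>m\<ge>0. v n \<le> up m \<and> v n + real n / 2 * \<alpha> m \<le> v 0)"
    using Suc by auto
  have pos: "0 \<le> real n / 2 * \<alpha> m" if "0 \<le> m" for m
    using class_K_nonneg[OF al that] by simp
  have "v n \<le> M" using IH M pos by fastforce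
  then consider "v (Suc n) \<le> \<eta>" | "v (Suc n) \<le> v n - \<alpha> (s n) / 2"
    using Suc.prems[of n] by auto
  then show ?case
  proof cases
    case 2
    have dec: "v (Suc n) \<le> v n" using 2 class_K_nonneg[OF al s(1)[of n]] by linarith
    show ?thesis
    proof (cases "v n \<le> \<eta>")
      case False
      with IH obtain m where m: "0 \<le> m" "v n \<le> up m" "v n + real n / 2 * \<alpha> m \<le> v 0" by blast
      let ?m = "min m (s n)"
      have m0: "0 \<le> ?m" using m s by simp
      have "v (Suc n) \<le> up ?m" using dec m(2) s(2)[of n] by (simp add: min_def)
      moreover have "\<alpha> ?m \<le> \<alpha> m" "\<alpha> ?m \<le> \<alpha> (s n)"
        using m0 by (auto intro!: class_K_mono[OF al])
      moreover from this have "real n / 2 * \<alpha> ?m \<le> real n / 2 * \<alpha> m"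
        by (intro mult_left_mono) auto
      ultimately have "v (Suc n) \<le> up ?m \<and> v (Suc n) + real (Suc n) / 2 * \<alpha> ?m \<le> v 0"
        using 2 m(3) by (simp add: add_divide_distrib distrib_right)
      with m0 show ?thesis by blast
    qed (use dec in auto)
  qed simp
qed

section \<open>Value iteration as a Lyapunov function\<close>

lemma value_iter_nonneg:
  assumes "\<And>x. U x \<noteq> {}" "\<And>x u. 0 \<le> l x u" "\<And>x. 0 \<le> V0 \<gamma> x" "0 \<le> \<gamma>"
  shows "0 \<le> value_iter f U l V0 \<gamma> j x"
proof (induction j arbitrary: x)
  case (Suc j)
  then show ?case using assms by (auto intro!: cINF_greatest add_nonneg_nonneg mult_nonneg_nonneg)
qed (use assms in simp)

lemma value_iter_Suc_ge_stage_bound: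
  assumes "\<And>x. U x \<noteq> {}" "\<And>x u. 0 \<le> l x u" "\<And>x. 0 \<le> V0 \<gamma> x" "0 \<le> \<gamma>"
    and "\<And>u. u \<in> U x \<Longrightarrow> b \<le> l x u"
  shows "b \<le> value_iter f U l V0 \<gamma> (Suc j) x"
  using assms value_iter_nonneg[of U l V0 \<gamma> f j]
  by (auto intro!: cINF_greatest add_increasing2 mult_nonneg_nonneg)

text \<open>
  In use, \<open>L\<close> is the stage cost and \<open>w\<close> the upper bound on the value function. Discounting
  costs \<open>(1 - \<gamma>) * v\<close> of the decrease; the bound on \<open>v\<close> and the choice of \<open>\<gamma>_star\<close> ensure that the stage cost pays for it and leaves \<open>a\<close>.
\<close>

lemma relaxed_bellman_decrease:
  fixes v v' L c w a b \<gamma> \<gamma>_star :: real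
  assumes \<gamma>: "0 < \<gamma>" "\<gamma>_star \<le> \<gamma>" "\<gamma> \<le> 1"
    and bellman: "L + \<gamma> * v' \<le> v + c"
    and v: "0 \<le> v" "v \<le> w"
    and L: "b \<le> L" "a + (1 - \<gamma>_star) * w \<le> b"
  shows "v' \<le> v + (c - a) / \<gamma>"
proof -
  have "(1 - \<gamma>) * v \<le> (1 - \<gamma>_star) * w"
    using \<gamma> v by (intro mult_mono) auto
  then have "\<gamma> * v' \<le> \<gamma> * v + (c - a)"
    using bellman L by (simp add: algebra_simps)
  then show ?thesis using \<gamma>(1) by (simp add: field_simps)
qed

text \<open>
  For \<open>t > 0\<close> monotonicity in the first argument reduces the claim to \<open>r = S\<close>. That
  argument is unavailable at \<open>t = 0\<close>, where instead every \<open>\<zeta> r 0\<close> vanishes, for \<open>r = 0\<close> by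
  the separate hypothesis.
\<close>

lemma zeta_uniformly_small:
  fixes \<zeta> :: "real \<Rightarrow> real \<Rightarrow> real"
  assumes \<zeta>: "\<forall>s>0. class_K (\<zeta> s) \<and> mono_on {0..} (\<lambda>r. \<zeta> r s)" and "\<zeta> 0 0 = 0"
    and "0 < S" "0 < \<epsilon>"
  obtains \<tau> where "0 < \<tau>" "\<And>r t. 0 \<le> r \<Longrightarrow> r \<le> S \<Longrightarrow> 0 \<le> t \<Longrightarrow> t \<le> \<tau> \<Longrightarrow> \<zeta> r t \<le> \<epsilon>"
proof -
  have K: "class_K (\<zeta> S)" using assms by auto
  obtain \<tau> where \<tau>: "0 < \<tau>" "\<zeta> S \<tau> < \<epsilon>" using class_K_small[OF K \<open>0 < \<epsilon>\<close>] .
  have "\<zeta> r t \<le> \<epsilon>" if rt: "0 \<le> r" "r \<le> S" "0 \<le> t" "t \<le> \<tau>" for r t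
  proof (cases "t = 0")
    case True
    then have "\<zeta> r t = 0"
      using assms(1,2) rt(1) by (cases "r = 0") (auto simp: class_K_def)
    then show ?thesis using \<open>0 < \<epsilon>\<close> by simp
  next
    case False
    then have "\<zeta> r t \<le> \<zeta> S t"
      using \<zeta> rt by (auto simp: monotone_on_def)
    also have "\<dots> \<le> \<zeta> S \<tau>" using rt by (intro class_K_mono[OF K])
    finally show ?thesis using \<tau> by simp
  qed
  with \<tau>(1) that show thesis by blast
qed

section \<open>Practical stability\<close>

theorem theorem7:
  fixes f :: "real ^ 'nx \<Rightarrow> real ^ 'nu \<Rightarrow> real ^ 'nx"
    and U :: "real ^ 'nx \<Rightarrow> (real ^ 'nu) set"
    and l :: "real ^ 'nx \<Rightarrow> real ^ 'nu \<Rightarrow> real"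
    and V0 :: "real \<Rightarrow> real ^ 'nx \<Rightarrow> real"
    and \<sigma> :: "real ^ 'nx \<Rightarrow> real"
    and \<Theta> :: "(real ^ 'ntheta) set"
    and X :: "(real ^ 'nx) set"
    and c_stop :: "real ^ 'nx \<Rightarrow> real ^ 'ntheta \<Rightarrow> real \<Rightarrow> nat \<Rightarrow> real"
    and \<alpha>_l \<alpha>_lo \<alpha>_up \<alpha> :: "real \<Rightarrow> real"
    and \<gamma>_star :: real
    and \<zeta> :: "real \<Rightarrow> real \<Rightarrow> real"
  assumes l_nonneg: "\<forall>x u. 0 \<le> l x u"
    and V0_nonneg: "\<forall>\<gamma>\<in>{0<..1}. \<forall>x. 0 \<le> V0 \<gamma> x"
    and sigma_cont: "continuous_on UNIV \<sigma>"
    and sigma_surj: "range \<sigma> = {0..}"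
    and c_stop_nonneg: "\<forall>x. \<forall>\<theta>\<in>\<Theta>. \<forall>\<gamma>\<in>{0<..1}. \<forall>i. 0 \<le> c_stop x \<theta> \<gamma> i"
    and f_cont: "continuous_on UNIV (\<lambda>(x, u). f x u)"
    and U_ne_closed: "\<forall>x. U x \<noteq> {} \<and> closed (U x)"
    and l_lsc: "lower_semicontinuous (\<lambda>(x, u). l x u)"
    and alpha_l: "class_K_inf \<alpha>_l" "\<forall>x u. l x u \<ge> \<alpha>_l (norm u)"
    and V0_lsc: "\<forall>\<gamma>\<in>{0<..1}. lower_semicontinuous (V0 \<gamma>)"
    and alpha_lo: "class_K_inf \<alpha>_lo" "\<forall>x. \<forall>u\<in>U x. l x u \<ge> \<alpha>_lo (\<sigma> x)"
    and alpha_up: "class_K_inf \<alpha>_up"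
      "\<forall>i. \<forall>\<gamma>\<in>{0<..1}. \<forall>x. value_iter f U l V0 \<gamma> i x \<le> \<alpha>_up (\<sigma> x)
         \<and> optimal_value f U l \<gamma> x \<le> ennreal (\<alpha>_up (\<sigma> x))"
    and gamma_star: "\<gamma>_star \<in> {0<..1}"
    and alpha: "class_K_inf \<alpha>" "\<forall>s\<ge>0. \<alpha> s + (1 - \<gamma>_star) * \<alpha>_up s \<le> \<alpha>_lo s"
    and zeta_nonneg: "\<forall>s\<ge>0. \<forall>t\<ge>0. 0 \<le> \<zeta> s t"
    and zeta: "\<forall>s>0. class_K (\<zeta> s) \<and> continuous_on {0..} (\<lambda>r. \<zeta> r s) \<and> mono_on {0..} (\<lambda>r. \<zeta> r s)"
    and zeta_0_0: "\<zeta> 0 0 = 0"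
    and c_stop_le: "\<forall>x. \<forall>\<theta>\<in>\<Theta>. \<forall>\<gamma>\<in>{0<..1}. \<forall>i. c_stop x \<theta> \<gamma> i \<le> \<zeta> (\<sigma> x) (norm \<theta>)"
  shows "\<exists>\<beta>. class_KL \<beta> \<and>
    (\<forall>\<delta>>0. \<forall>\<Delta>>0. \<forall>\<gamma>\<in>{\<gamma>_star..1}. \<forall>i\<ge>2. \<exists>\<theta>_bar>0.
       \<forall>x\<in>X. \<sigma> x \<le> \<Delta> \<longrightarrow>
         (\<forall>\<theta>\<in>\<Theta>. norm \<theta> \<le> \<theta>_bar \<longrightarrow>
            (\<forall>D \<phi>. constrained_solution f (H_hat f U l V0 c_stop \<gamma> i \<theta>) X x D \<phi> \<longrightarrow>
               (\<forall>k\<in>D. \<sigma> (\<phi> k) \<le> max (\<beta> (\<sigma> x) (real k)) \<delta>))))"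
proof (intro exI[of _ "decay_bound \<alpha>_lo \<alpha>_up \<alpha>"] conjI allI impI ballI)
  have loK: "class_K \<alpha>_lo" and upK: "class_K \<alpha>_up" and alK: "class_K \<alpha>"
    using alpha_lo(1) alpha_up(1) alpha(1) by (auto simp: class_K_inf_def)
  show "class_KL (decay_bound \<alpha>_lo \<alpha>_up \<alpha>)"
    by (rule class_KL_decay_bound[OF alpha_lo(1) upK alK])
  fix \<delta> \<Delta> \<gamma> :: real and i :: nat
  assume \<delta>: "0 < \<delta>" and \<Delta>: "0 < \<Delta>" and \<gamma>: "\<gamma> \<in> {\<gamma>_star..1}" and i: "2 \<le> i"
  define V where "V = value_iter f U l V0 \<gamma> (i - 1)"
  have g: "0 < \<gamma>" "\<gamma>_star \<le> \<gamma>" "\<gamma> \<le> 1" "\<gamma> \<in> {0<..1}" using \<gamma> gamma_star by auto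
  have \<sigma>0: "0 \<le> \<sigma> x" for x using sigma_surj by auto
  have V_lo: "\<alpha>_lo (\<sigma> x) \<le> V x" for x
    using value_iter_Suc_ge_stage_bound[of U l V0 \<gamma> x "\<alpha>_lo (\<sigma> x)" f "i - 2"]
      U_ne_closed l_nonneg V0_nonneg g alpha_lo(2) i
    by (simp add: V_def numeral_2_eq_2 Suc_diff_Suc del: value_iter.simps)
  have V_up: "V x \<le> \<alpha>_up (\<sigma> x)" for x
    using alpha_up(2) g by (auto simp: V_def)
  have V0: "0 \<le> V x" for x
    using V_lo[of x] class_K_nonneg[OF loK \<sigma>0[of x]] by linarith

  define \<eta> where "\<eta> = \<alpha>_lo \<delta>"
  \<comment> \<open>The level \<open>M\<close> contains all initial states and the region below \<open>\<eta>\<close>, which a solution may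
    enter and then move around in. On it, \<open>\<sigma>\<close> is at most \<open>S\<close>.\<close>
  define M where "M = max (\<alpha>_up \<Delta>) \<eta>"
  have \<eta>: "0 < \<eta>" using class_K_pos[OF loK \<delta>] by (simp add: \<eta>_def)
  obtain S where S: "0 < S" "M \<le> \<alpha>_lo S" using class_K_inf_large[OF alpha_lo(1)] .
  obtain d where d: "0 < d" "\<alpha>_up d < \<eta> / 2"
    using class_K_small[OF upK] \<eta> by (metis half_gt_zero)
  \<comment> \<open>The entries of the minimum are what the one-step dichotomy asks of \<open>\<epsilon>\<close>: from
    \<open>\<alpha> s < 2 * \<epsilon>\<close> follows \<open>s < d\<close>, and one perturbation adds at most \<open>\<eta> / 2\<close> to \<open>V\<close>.\<close>
  define \<epsilon> where "\<epsilon> = min (\<alpha> d / 2) (\<gamma> * \<eta> / 2)"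
  have \<epsilon>: "0 < \<epsilon>" "2 * \<epsilon> \<le> \<alpha> d" "\<epsilon> / \<gamma> \<le> \<eta> / 2"
    using class_K_pos[OF alK d(1)] \<eta> g(1) by (auto simp: \<epsilon>_def field_simps min_def)
  obtain \<tau> where \<tau>: "0 < \<tau>"
    "\<And>r t. 0 \<le> r \<Longrightarrow> r \<le> S \<Longrightarrow> 0 \<le> t \<Longrightarrow> t \<le> \<tau> \<Longrightarrow> \<zeta> r t \<le> \<epsilon>"
    using zeta_uniformly_small[of \<zeta> S \<epsilon>] zeta zeta_0_0 S(1) \<epsilon>(1) by blast

  have one_step: "V (f x u) \<le> \<eta> \<or> V (f x u) \<le> V x - \<alpha> (\<sigma> x) / 2"
    if Vx: "V x \<le> M" and \<theta>: "\<theta> \<in> \<Theta>" "norm \<theta> \<le> \<tau>"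
      and u: "u \<in> H_hat f U l V0 c_stop \<gamma> i \<theta> x" for x u \<theta>
  proof -
    have "\<sigma> x \<le> S"
      using V_lo[of x] Vx S \<sigma>0 by (intro class_K_le_cancel[OF loK, of "\<sigma> x" S]) auto
    then have "\<zeta> (\<sigma> x) (norm \<theta>) \<le> \<epsilon>" using \<theta> \<sigma>0 by (intro \<tau>(2)) auto
    then have c: "c_stop x \<theta> \<gamma> i \<le> \<epsilon>" using c_stop_le \<theta>(1) g(4) by (meson order_trans)
    have bell: "l x u + \<gamma> * V (f x u) \<le> V x + c_stop x \<theta> \<gamma> i" and uU: "u \<in> U x"
      using u by (auto simp: H_hat_def V_def)
    have "\<alpha>_lo (\<sigma> x) \<le> l x u" using alpha_lo(2) uU by blast
    moreover have "\<alpha> (\<sigma> x) + (1 - \<gamma>_star) * \<alpha>_up (\<sigma> x) \<le> \<alpha>_lo (\<sigma> x)" using alpha(2) \<sigma>0 by blast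
    ultimately have "V (f x u) \<le> V x + (c_stop x \<theta> \<gamma> i - \<alpha> (\<sigma> x)) / \<gamma>"
      by (rule relaxed_bellman_decrease[OF g(1-3) bell V0 V_up])
    then show ?thesis
      using c d \<epsilon> by (intro perturbed_decrease_dichotomy[OF upK alK g(1,3) \<sigma>0 V_up]) auto
  qed

  show "\<exists>\<theta>_bar>0. \<forall>x\<in>X. \<sigma> x \<le> \<Delta> \<longrightarrow>
         (\<forall>\<theta>\<in>\<Theta>. norm \<theta> \<le> \<theta>_bar \<longrightarrow>
            (\<forall>D \<phi>. constrained_solution f (H_hat f U l V0 c_stop \<gamma> i \<theta>) X x D \<phi> \<longrightarrow>
               (\<forall>k\<in>D. \<sigma> (\<phi> k) \<le> max (decay_bound \<alpha>_lo \<alpha>_up \<alpha> (\<sigma> x) (real k)) \<delta>)))"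
  proof (intro exI[of _ \<tau>] conjI \<tau>(1) ballI allI impI)
    fix x \<theta> D \<phi> k
    assume x: "\<sigma> x \<le> \<Delta>" and \<theta>: "\<theta> \<in> \<Theta>" "norm \<theta> \<le> \<tau>" and k: "k \<in> D"
      and sol: "constrained_solution f (H_hat f U l V0 c_stop \<gamma> i \<theta>) X x D \<phi>"
    have \<phi>0: "\<phi> 0 = x" using sol by (simp add: constrained_solution_def)
    have "V (\<phi> k) \<le> \<eta> \<or>
      (\<exists>m\<ge>0. V (\<phi> k) \<le> \<alpha>_up m \<and> V (\<phi> k) + real k / 2 * \<alpha> m \<le> V (\<phi> 0))"
    proof (rule accumulated_decrease[OF upK alK, where s = "\<lambda>k. \<sigma> (\<phi> k)" and M = M])
      have "V x \<le> \<alpha>_up \<Delta>"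
        using V_up[of x] class_K_mono[OF upK \<sigma>0 x] by linarith
      then show "V (\<phi> 0) \<le> M" by (simp add: \<phi>0 M_def)
    next
      fix j assume j: "j < k" "V (\<phi> j) \<le> M"
      have "Suc j \<in> D" using sol k j(1) by (auto simp: constrained_solution_def)
      then obtain u where "u \<in> H_hat f U l V0 c_stop \<gamma> i \<theta> (\<phi> j)" "\<phi> (Suc j) = f (\<phi> j) u"
        using sol by (auto simp: constrained_solution_def)
      then show "V (\<phi> (Suc j)) \<le> \<eta> \<or> V (\<phi> (Suc j)) \<le> V (\<phi> j) - \<alpha> (\<sigma> (\<phi> j)) / 2"
        using one_step[OF j(2) \<theta>] by simp
    qed (auto simp: \<sigma>0 V_up M_def)
    then consider "V (\<phi> k) \<le> \<eta>"
      | m where "0 \<le> m" "V (\<phi> k) \<le> \<alpha>_up m" "V (\<phi> k) + real k / 2 * \<alpha> m \<le> V (\<phi> 0)"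
      by blast
    then show "\<sigma> (\<phi> k) \<le> max (decay_bound \<alpha>_lo \<alpha>_up \<alpha> (\<sigma> x) (real k)) \<delta>"
    proof cases
      case 1
      then have "\<sigma> (\<phi> k) \<le> \<delta>"
        using V_lo[of "\<phi> k"] \<delta> \<sigma>0
        by (intro class_K_le_cancel[OF loK, of "\<sigma> (\<phi> k)" \<delta>]) (auto simp: \<eta>_def)
      then show ?thesis by simp
    next
      case 2
      then have "\<sigma> (\<phi> k) \<in> decay_set \<alpha>_lo \<alpha>_up \<alpha> (\<sigma> x) (real k)"
        using V_lo[of "\<phi> k"] V_up[of x] \<sigma>0 \<phi>0
        by (auto simp: decay_set_def intro!: exI[of _ m])
      then have "\<sigma> (\<phi> k) \<le> decay_bound \<alpha>_lo \<alpha>_up \<alpha> (\<sigma> x) (real k)"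
        by (intro le_decay_bound[OF alpha_lo(1) upK alK]) auto
      then show ?thesis by simp
    qed
  qed
qed

end
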